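(* Let $S$ be a semigroup generated by its squares, let $\sigma:S\to S$ be an involutive automorphism, and let $\mu:S\to\mathbb{C}$ be a multiplicative function such that $\mu(x\sigma(x))=1$ for all $x\in S$. The solutions $(f,g)$, with $f,g:S\to\mathbb{C}$, of the functional equation $$f(xy)+\mu(y)f(\sigma(y)x)=2f(x)g(y)\quad\text{for all } x,y\in S$$ are exactly the following pairs: (1) $f=0$ and $g$ is arbitrary. (2) $f=\lambda\chi+\delta\chi^{*}$ and $g=\dfrac{\chi+\chi^{*}}{2}$, where $\chi:S\to\mathbb{C}$ is a nonzero multiplicative function and $\lambda,\delta\in\mathbb{C}$ are constants such that $(\lambda,\delta)\neq(0,0)$. (3) $f=\chi(c+A)$ and $g=\chi$ on $S\setminus I_{\chi}$, and $f=0$ and $g=0$ on $I_{\chi}$, where $c\in\mathbb{C}$ is a constant, $\chi:S\to\mathbb{C}$ is a nonzero multiplicative function and $A:S\setminus I_{\chi}\to\mathbb{C}$ is a nonzero additive function such that $\chi=\chi^{*}$ and $A\circ\sigma=-A$. That is, every solution is of one of the forms (1)-(3), and conversely every pair of one of these forms is a solution.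
   Context: A semigroup is a set with an associative composition (no identity element is assumed). $S$ is generated by its squares if every element of $S$ is a finite product of elements of the form $x^2=xx$, $x\in S$. An involutive automorphism is a semigroup automorphism $\sigma:S\to S$ (so $\sigma(xy)=\sigma(x)\sigma(y)$) with $\sigma(\sigma(x))=x$ for all $x\in S$. A function $\chi:S\to\mathbb{C}$ is multiplicative if $\chi(xy)=\chi(x)\chi(y)$ for all $x,y\in S$. For $F:S\to\mathbb{C}$, the function $F^{*}:S\to\mathbb{C}$ is defined by $F^{*}(x)=\mu(x)F(\sigma(x))$. For a multiplicative function $\chi:S\to\mathbb{C}$, $I_{\chi}:=\{x\in S\mid \chi(x)=0\}$; when $\chi\neq 0$, $S\setminus I_{\chi}$ is a subsemigroup of $S$, and when $\chi=\chi^{*}$, $\sigma$ maps $S\setminus I_\chi$ onto itself. A function $A$ from a semigroup $T$ to $\mathbb{C}$ is additive if $A(xy)=A(x)+A(y)$ for all $x,y\in T$. *)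

theory Defs
  imports Complex_Main
begin

inductive_set square_products :: "'a::semigroup_mult set" where
  square: "x * x \<in> square_products"
| mult: "p \<in> square_products \<Longrightarrow> q \<in> square_products \<Longrightarrow> p * q \<in> square_products"

text \<open>The type plays the role of the semigroup \<open>S\<close>; the parameter is only there to name it.\<close>

definition generated_by_squares :: "'a::semigroup_mult itself \<Rightarrow> bool" where
  "generated_by_squares _ \<longleftrightarrow> (\<forall>x::'a. x \<in> square_products)"

definition involutive_automorphism :: "('a::semigroup_mult \<Rightarrow> 'a) \<Rightarrow> bool" where
  "involutive_automorphism \<sigma> \<longleftrightarrow>
     (\<forall>x y. \<sigma> (x * y) = \<sigma> x * \<sigma> y) \<and> (\<forall>x. \<sigma> (\<sigma> x) = x)"

definition multiplicative :: "('a::semigroup_mult \<Rightarrow> complex) \<Rightarrow> bool" where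
  "multiplicative \<chi> \<longleftrightarrow> (\<forall>x y. \<chi> (x * y) = \<chi> x * \<chi> y)"

definition star ::
  "('a::semigroup_mult \<Rightarrow> complex) \<Rightarrow> ('a \<Rightarrow> 'a) \<Rightarrow> ('a \<Rightarrow> complex) \<Rightarrow> 'a \<Rightarrow> complex" where
  "star \<mu> \<sigma> F = (\<lambda>x. \<mu> x * F (\<sigma> x))"

definition null_ideal :: "('a::semigroup_mult \<Rightarrow> complex) \<Rightarrow> 'a set" where
  "null_ideal \<chi> = {x. \<chi> x = 0}"

text \<open>Functions on a subsemigroup \<open>T\<close> are represented by total functions whose values
  outside \<open>T\<close> are unconstrained and never used.\<close>

definition additive_on :: "'a::semigroup_mult set \<Rightarrow> ('a \<Rightarrow> complex) \<Rightarrow> bool" where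
  "additive_on T A \<longleftrightarrow> (\<forall>x\<in>T. \<forall>y\<in>T. A (x * y) = A x + A y)"

end

theory Submission
  imports Defs
begin

text \<open>
  For every \<open>x\<close> the function \<open>y \<mapsto> f (x * y) - f x * g y\<close> satisfies the sine addition law
  \<open>h (y * z) = h y * g z + g y * h z\<close> with the same companion \<open>g\<close>. If all these functions vanish,
  then \<open>g\<close> is multiplicative, \<open>g\<close> equals its own star and \<open>f\<close> is a multiple of \<open>g\<close>. Otherwise
  \<open>g\<close> is the mean of the multiplicative functions \<open>g + \<beta> h\<close> and \<open>g - \<beta> h\<close> for some constant \<open>\<beta>\<close>.
  Comparing the right translates \<open>f (x * y)\<close> given by the sine addition law with the left
  translates \<open>f (\<sigma> y * x)\<close> given by the functional equation identifies these two functions as the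
  star of each other, and determines \<open>f\<close>.
\<close>

section \<open>Multiplicative functions: proportionality and linear independence\<close>

lemma multiplicativeD: "multiplicative \<chi> \<Longrightarrow> \<chi> (x * y) = \<chi> x * \<chi> y"
  by (simp add: multiplicative_def)

text \<open>Evaluating at \<open>x0 * x0\<close> gives \<open>k = k^2\<close> up to the nonzero
  factor \<open>\<psi> x0 * \<psi> x0\<close>, and \<open>k\<close> is nonzero.\<close>

lemma multiplicative_proportional_eq:
  assumes "multiplicative \<chi>" "multiplicative \<psi>" and nz: "\<chi> x0 \<noteq> 0"
    and scaled: "\<And>x. \<chi> x = k * \<psi> x"
  shows "\<chi> = \<psi>"
proof -
  have "k * (\<psi> x0 * \<psi> x0) = (k * \<psi> x0) * (k * \<psi> x0)"
    using scaled multiplicativeD[OF assms(1)] multiplicativeD[OF assms(2)] by metis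
  moreover have "k \<noteq> 0" "\<psi> x0 \<noteq> 0"
    using nz scaled by auto
  ultimately have "k = 1" by simp
  then show ?thesis using scaled by auto
qed

text \<open>Choose \<open>w\<close> separating the two functions. Subtracting
  \<open>\<psi> w\<close> times the relation at \<open>x0\<close> from the relation at
  \<open>x0 * w\<close> eliminates \<open>b\<close>.\<close>

lemma multiplicative_independent:
  assumes "multiplicative \<chi>" "multiplicative \<psi>" "\<chi> x0 \<noteq> 0" "\<psi> y0 \<noteq> 0" "\<chi> \<noteq> \<psi>"
    and zero: "\<And>z. a * \<chi> z + b * \<psi> z = 0"
  shows "a = 0" "b = 0"
proof -
  obtain w where w: "\<chi> w \<noteq> \<psi> w" using \<open>\<chi> \<noteq> \<psi>\<close> by auto
  have "a * \<chi> x0 * (\<chi> w - \<psi> w) = 0"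
  proof -
    have "a * (\<chi> x0 * \<chi> w) + b * (\<psi> x0 * \<psi> w) = 0"
      using zero[of "x0 * w"] by (simp add: multiplicativeD assms(1,2))
    moreover have "(a * \<chi> x0 + b * \<psi> x0) * \<psi> w = 0"
      by (simp add: zero)
    moreover have "a * \<chi> x0 * (\<chi> w - \<psi> w)
        = (a * (\<chi> x0 * \<chi> w) + b * (\<psi> x0 * \<psi> w)) - (a * \<chi> x0 + b * \<psi> x0) * \<psi> w"
      by (simp add: algebra_simps)
    ultimately show ?thesis by simp
  qed
  then show "a = 0" using w \<open>\<chi> x0 \<noteq> 0\<close> by simp
  then show "b = 0" using zero[of y0] \<open>\<psi> y0 \<noteq> 0\<close> by simp
qed

lemma multiplicative_independent_eq:
  assumes "multiplicative \<chi>" "multiplicative \<psi>" "\<chi> x0 \<noteq> 0" "\<psi> y0 \<noteq> 0" "\<chi> \<noteq> \<psi>"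
    and eq: "\<And>z. a * \<chi> z + b * \<psi> z = c * \<chi> z + d * \<psi> z"
  shows "a = c" "b = d"
  using multiplicative_independent[OF assms(1-5), of "a - c" "b - d"] eq
  by (simp_all add: algebra_simps)

section \<open>Semigroups generated by their squares\<close>

lemma generated_by_squares_induct [consumes 1, case_names square mult]:
  fixes x :: "'a::semigroup_mult"
  assumes "generated_by_squares TYPE('a)"
    and "\<And>x. P (x * x)" "\<And>p q. P p \<Longrightarrow> P q \<Longrightarrow> P (p * q)"
  shows "P x"
proof -
  have "x \<in> square_products" using assms(1) by (simp add: generated_by_squares_def)
  then show ?thesis by induction (use assms in auto)
qed

lemma generated_by_squares_vanish:
  fixes h :: "'a::semigroup_mult \<Rightarrow> complex"
  assumes "generated_by_squares TYPE('a)" "\<And>x y. h (x * y) = 0"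
  shows "h x = 0"
  by (induction x rule: generated_by_squares_induct[OF assms(1)]) (simp_all add: assms(2))

section \<open>The sine addition law\<close>

definition sine_addition_law ::
  "('a::semigroup_mult \<Rightarrow> complex) \<Rightarrow> ('a \<Rightarrow> complex) \<Rightarrow> bool" where
  "sine_addition_law h g \<longleftrightarrow> (\<forall>y z. h (y * z) = h y * g z + g y * h z)"

lemma sine_addition_lawD: "sine_addition_law h g \<Longrightarrow> h (y * z) = h y * g z + g y * h z"
  by (simp add: sine_addition_law_def)

text \<open>The two bracketings of the product of \<open>x\<close>, \<open>y\<close>,
  \<open>z\<close> give two expansions of \<open>h\<close>, which are compared.\<close>

lemma sine_addition_law_exchange:
  assumes "sine_addition_law h g"
  shows "h z * (g (x * y) - g x * g y) = h x * (g (y * z) - g y * g z)"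
proof -
  note h = sine_addition_lawD[OF assms]
  have "h (x * y * z) = (h x * g y + g x * h y) * g z + g (x * y) * h z"
    by (subst h, subst h) simp
  moreover have "h (x * (y * z)) = h x * g (y * z) + g x * (h y * g z + g y * h z)"
    by (subst h, subst h) simp
  ultimately show ?thesis by (simp add: algebra_simps)
qed

lemma sine_addition_law_companion:
  assumes "sine_addition_law h g" and z0: "h z0 \<noteq> 0"
  obtains \<beta> where "\<And>x y. g (x * y) = g x * g y + \<beta>^2 * h x * h y"
proof -
  define \<phi> where "\<phi> y = (g (y * z0) - g y * g z0) / h z0" for y
  have g: "g (x * y) - g x * g y = h x * \<phi> y" for x y
    using sine_addition_law_exchange[OF assms(1), of z0 x y] z0
    by (simp add: \<phi>_def field_simps)
  \<comment> \<open>The exchange identity, with \<open>z0\<close> in two of its three places, makes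
    \<open>\<phi>\<close> proportional to \<open>h\<close>.\<close>
  have "h z0 * (h z0 * \<phi> y) = h z0 * (h y * \<phi> z0)" for y
    using sine_addition_law_exchange[OF assms(1), of z0 z0 y] by (simp add: g)
  then have \<phi>: "\<phi> y = (\<phi> z0 / h z0) * h y" for y
    using z0 by (simp add: field_simps)
  \<comment> \<open>The factor is written as a square so that \<open>g + \<beta> * h\<close> and
    \<open>g - \<beta> * h\<close> become multiplicative.\<close>
  have "g (x * y) = g x * g y + (csqrt (\<phi> z0 / h z0))^2 * h x * h y" for x y
    using g[of x y] \<phi>[of y] by (simp add: algebra_simps)
  then show ?thesis by (rule that)
qed

text \<open>Induction over products of squares: \<open>h (x * x) = 2 * h x * \<chi> x\<close>
  settles squares, and in a product the factor where \<open>\<chi>\<close> vanishes also has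
  \<open>h\<close> zero by induction.\<close>

lemma sine_addition_law_vanish:
  fixes h :: "'a::semigroup_mult \<Rightarrow> complex"
  assumes "generated_by_squares TYPE('a)" "sine_addition_law h \<chi>" "multiplicative \<chi>" "\<chi> x = 0"
  shows "h x = 0"
proof -
  have "\<chi> x = 0 \<longrightarrow> h x = 0"
    by (induction x rule: generated_by_squares_induct[OF assms(1)])
      (auto simp: sine_addition_lawD[OF assms(2)] multiplicativeD[OF assms(3)])
  then show ?thesis using assms(4) by simp
qed

section \<open>The star operation, and the listed pairs as solutions\<close>

locale mu_involution =
  fixes \<sigma> :: "'a::semigroup_mult \<Rightarrow> 'a" and \<mu> :: "'a \<Rightarrow> complex"
  assumes involutive: "involutive_automorphism \<sigma>"
    and mult_mu: "multiplicative \<mu>"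
    and mu_norm: "\<mu> (x * \<sigma> x) = 1"
begin

lemma sigma_mult: "\<sigma> (x * y) = \<sigma> x * \<sigma> y" and sigma_sigma [simp]: "\<sigma> (\<sigma> x) = x"
  using involutive by (auto simp: involutive_automorphism_def)

lemma mu_sigma: "\<mu> x * \<mu> (\<sigma> x) = 1"
  using mu_norm[of x] by (simp add: multiplicativeD[OF mult_mu])

lemma mu_sigma_cancel: "\<mu> x * (\<mu> (\<sigma> x) * z) = z"
  by (simp add: mult.assoc[symmetric] mu_sigma)

lemma mu_nonzero: "\<mu> x \<noteq> 0"
  using mu_sigma[of x] by auto

lemma star_star: "star \<mu> \<sigma> (star \<mu> \<sigma> F) = F"
  by (simp add: star_def mu_sigma_cancel)

lemma star_sigma: "\<mu> y * star \<mu> \<sigma> F (\<sigma> y) = F y"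
  by (simp add: star_def mu_sigma_cancel)

lemma multiplicative_star: "multiplicative \<chi> \<Longrightarrow> multiplicative (star \<mu> \<sigma> \<chi>)"
  using mult_mu by (simp add: multiplicative_def star_def sigma_mult)

lemma star_nonzero: "F x \<noteq> 0 \<Longrightarrow> star \<mu> \<sigma> F (\<sigma> x) \<noteq> 0"
  using mu_nonzero by (simp add: star_def)

text \<open>Where \<open>\<chi> x\<close> and \<open>\<chi> y\<close> are nonzero, the two terms on
  the left contain \<open>A x + A y\<close> and \<open>A x - A y\<close> with equal prefactors, so
  \<open>A y\<close> cancels. Otherwise every term is zero.\<close>

lemma star_fixed_imp_equation:
  assumes chi: "multiplicative \<chi>" and fixed: "\<chi> = star \<mu> \<sigma> \<chi>"
    and A: "additive_on (- null_ideal \<chi>) A" "\<forall>x\<in>- null_ideal \<chi>. A (\<sigma> x) = - A x"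
    and nz: "\<forall>x\<in>- null_ideal \<chi>. f x = \<chi> x * (c + A x) \<and> g x = \<chi> x"
    and null: "\<forall>x\<in>null_ideal \<chi>. f x = 0 \<and> g x = 0"
  shows "f (x * y) + \<mu> y * f (\<sigma> y * x) = 2 * f x * g y"
proof -
  note chiD = multiplicativeD[OF chi]
  have chi_sigma: "\<mu> u * \<chi> (\<sigma> u) = \<chi> u" for u
    using fun_cong[OF fixed, of u] by (simp add: star_def)
  show ?thesis
  proof (cases "\<chi> x = 0 \<or> \<chi> y = 0")
    case True
    then have "\<chi> (x * y) = 0" "\<chi> (\<sigma> y * x) = 0"
      using chi_sigma[of y] mu_nonzero[of y] by (auto simp: chiD)
    then show ?thesis using null True by (auto simp: null_ideal_def)
  next
    case False
    then have sy: "\<chi> (\<sigma> y) \<noteq> 0" using chi_sigma[of y] by auto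
    have "f (x * y) = \<chi> x * \<chi> y * (c + A x + A y)"
      using False A(1) nz by (simp add: null_ideal_def chiD additive_on_def add.assoc)
    moreover have "f (\<sigma> y * x) = \<chi> (\<sigma> y) * \<chi> x * (c - A y + A x)"
      using False A nz sy by (simp add: null_ideal_def chiD additive_on_def)
    then have "\<mu> y * f (\<sigma> y * x) = (\<mu> y * \<chi> (\<sigma> y)) * \<chi> x * (c - A y + A x)"
      by simp
    moreover have "f x = \<chi> x * (c + A x)" "g y = \<chi> y"
      using False nz by (auto simp: null_ideal_def)
    ultimately show ?thesis by (simp add: chi_sigma algebra_simps)
  qed
qed

text \<open>Passing from \<open>f (x * y)\<close> to \<open>\<mu> y * f (\<sigma> y * x)\<close>
  interchanges the factors \<open>\<chi> y\<close> and \<open>star \<mu> \<sigma> \<chi> y\<close>,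
  so the sum contains both in front of each summand of \<open>f x\<close>.\<close>

lemma star_sum_imp_equation:
  assumes chi: "multiplicative \<chi>"
    and f: "\<And>x. f x = \<alpha> * \<chi> x + \<delta> * star \<mu> \<sigma> \<chi> x"
    and g: "\<And>x. g x = (\<chi> x + star \<mu> \<sigma> \<chi> x) / 2"
  shows "f (x * y) + \<mu> y * f (\<sigma> y * x) = 2 * f x * g y"
proof -
  have "\<mu> y * f (\<sigma> y * x)
      = \<alpha> * (\<mu> y * \<chi> (\<sigma> y)) * \<chi> x + \<delta> * (\<mu> y * star \<mu> \<sigma> \<chi> (\<sigma> y)) * star \<mu> \<sigma> \<chi> x"
    by (simp add: f multiplicativeD[OF chi] multiplicativeD[OF multiplicative_star[OF chi]]
        algebra_simps)
  also have "\<dots> = \<alpha> * star \<mu> \<sigma> \<chi> y * \<chi> x + \<delta> * \<chi> y * star \<mu> \<sigma> \<chi> x"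
    by (simp add: star_sigma) (simp add: star_def)
  finally have left:
    "\<mu> y * f (\<sigma> y * x) = \<alpha> * star \<mu> \<sigma> \<chi> y * \<chi> x + \<delta> * \<chi> y * star \<mu> \<sigma> \<chi> x" .
  show ?thesis
    unfolding left
    by (simp add: f g multiplicativeD[OF chi] multiplicativeD[OF multiplicative_star[OF chi]]
        field_simps)
qed

end

section \<open>Translates of a nonzero solution and their defects\<close>

locale wilson_variant = mu_involution \<sigma> \<mu> for \<sigma> :: "'a::semigroup_mult \<Rightarrow> 'a" and \<mu> +
  fixes f g :: "'a \<Rightarrow> complex"
  assumes squares: "generated_by_squares TYPE('a)"
    and equation: "f (x * y) + \<mu> y * f (\<sigma> y * x) = 2 * f x * g y"
    and f_nonzero: "\<exists>x. f x \<noteq> 0"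
begin

definition defect :: "'a \<Rightarrow> 'a \<Rightarrow> complex" where
  "defect x y = f (x * y) - f x * g y"

lemma f_mult: "f (x * y) = f x * g y + defect x y"
  by (simp add: defect_def)

text \<open>The functional equation at \<open>\<sigma> y\<close>, multiplied by
  \<open>\<mu> y\<close>, turns the formula for right translates into one for left translates. The
  defect changes sign.\<close>

lemma f_mult_left: "f (y * x) = f x * star \<mu> \<sigma> g y - star \<mu> \<sigma> (defect x) y"
proof -
  have "f (x * \<sigma> y) + \<mu> (\<sigma> y) * f (y * x) = 2 * f x * g (\<sigma> y)"
    using equation[of x "\<sigma> y"] by simp
  then have "\<mu> (\<sigma> y) * f (y * x) = f x * g (\<sigma> y) - defect x (\<sigma> y)"
    by (simp add: f_mult[of x "\<sigma> y"] algebra_simps)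
  then have "\<mu> y * (\<mu> (\<sigma> y) * f (y * x)) = \<mu> y * (f x * g (\<sigma> y) - defect x (\<sigma> y))"
    by simp
  then show ?thesis by (simp add: mu_sigma_cancel star_def algebra_simps)
qed

text \<open>Adding the equations at \<open>(x, y * z)\<close> and \<open>(x * y, z)\<close> and
  subtracting \<open>\<mu> z\<close> times the one at \<open>(\<sigma> z * x, y)\<close> isolates
  \<open>2 * f (x * y * z)\<close>. The equation at \<open>(x, z)\<close> then removes the remaining
  \<open>\<sigma>\<close>.\<close>

lemma defect_sine: "sine_addition_law (defect x) g"
  unfolding sine_addition_law_def
proof (intro allI)
  fix y z
  have e1: "f (x * y * z) + \<mu> y * \<mu> z * f (\<sigma> y * \<sigma> z * x) = 2 * f x * g (y * z)"
    using equation[of x "y * z"] by (simp add: sigma_mult multiplicativeD[OF mult_mu] mult.assoc)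
  have e2: "\<mu> z * f (\<sigma> z * x * y) + \<mu> y * \<mu> z * f (\<sigma> y * \<sigma> z * x) = 2 * (\<mu> z * f (\<sigma> z * x)) * g y"
    using arg_cong[OF equation[of "\<sigma> z * x" y], of "\<lambda>t. \<mu> z * t"]
    by (simp add: mult.assoc distrib_left mult.left_commute)
  have e3: "f (x * y * z) + \<mu> z * f (\<sigma> z * x * y) = 2 * f (x * y) * g z"
    using equation[of "x * y" z] by (simp add: mult.assoc)
  have e4: "\<mu> z * f (\<sigma> z * x) = 2 * f x * g z - f (x * z)"
    using equation[of x z] by (simp add: algebra_simps)
  have "2 * f (x * y * z) = (f (x * y * z) + \<mu> z * f (\<sigma> z * x * y))
      + (f (x * y * z) + \<mu> y * \<mu> z * f (\<sigma> y * \<sigma> z * x))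
      - (\<mu> z * f (\<sigma> z * x * y) + \<mu> y * \<mu> z * f (\<sigma> y * \<sigma> z * x))"
    by simp
  also have "\<dots> = 2 * (f (x * y) * g z + f x * g (y * z) - (2 * f x * g z - f (x * z)) * g y)"
    unfolding e1 e2 e3 e4 by (simp add: right_diff_distrib distrib_left)
  finally have "f (x * y * z)
      = f (x * y) * g z + f x * g (y * z) - (2 * f x * g z - f (x * z)) * g y"
    by (rule iffD1[OF mult_left_cancel, rotated]) simp
  then show "defect x (y * z) = defect x y * g z + g y * defect x z"
    by (simp add: defect_def algebra_simps)
qed

text \<open>If \<open>g\<close> were zero, the sine law would kill every defect on products, hence
  everywhere. Then \<open>f\<close> would vanish on products, hence everywhere.\<close>

lemma g_nonzero: "\<exists>x. g x \<noteq> 0"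
proof (rule ccontr)
  assume "\<not> ?thesis"
  then have g: "g x = 0" for x by simp
  have "defect x (y * z) = 0" for x y z
    using sine_addition_lawD[OF defect_sine, of x y z] by (simp add: g)
  then have "defect x y = 0" for x y
    by (rule generated_by_squares_vanish[OF squares])
  then have "f (x * y) = 0" for x y by (simp add: f_mult g)
  then have "f x = 0" for x by (rule generated_by_squares_vanish[OF squares])
  then show False using f_nonzero by simp
qed

text \<open>Without defects, \<open>f (y * x)\<close> equals both \<open>f y * g x\<close> and
  \<open>f x * star \<mu> \<sigma> g y\<close>. Fixing one argument or the other makes
  \<open>f\<close> proportional to \<open>g\<close> and to its star, so these two agree.\<close>

lemma defect_zero_solution:
  assumes "\<And>x y. defect x y = 0"
  obtains c where "multiplicative g" "star \<mu> \<sigma> g = g" "c \<noteq> 0" "\<And>x. f x = c * g x"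
proof -
  have right: "f (x * y) = f x * g y" for x y
    by (simp add: f_mult assms)
  have left: "f (y * x) = f x * star \<mu> \<sigma> g y" for x y
    using f_mult_left[of y x] by (simp add: star_def assms)
  obtain x0 where x0: "f x0 \<noteq> 0" using f_nonzero by blast
  have "f x0 * g (y * z) = f x0 * (g y * g z)" for y z
    by (metis right mult.assoc)
  then have mult: "multiplicative g" using x0 by (simp add: multiplicative_def)
  obtain y0 where y0: "g y0 \<noteq> 0" using g_nonzero by blast
  have f1: "f y = (f y0 / g y0) * star \<mu> \<sigma> g y" for y
    using right[of y y0] left[of y y0] y0 by (simp add: field_simps)
  have "star \<mu> \<sigma> g (\<sigma> y0) \<noteq> 0" using y0 by (rule star_nonzero)
  then have f2: "f y = (f (\<sigma> y0) / star \<mu> \<sigma> g (\<sigma> y0)) * g y" for y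
    using right[of "\<sigma> y0" y] left[of "\<sigma> y0" y] by (simp add: field_simps)
  define c where "c = f (\<sigma> y0) / star \<mu> \<sigma> g (\<sigma> y0)"
  have f2: "f y = c * g y" for y unfolding c_def by (rule f2)
  have c: "c \<noteq> 0" using f2[of x0] x0 by auto
  have "g y = (f y0 / g y0 / c) * star \<mu> \<sigma> g y" for y
    using f1[of y] f2[of y] c y0 by (simp add: field_simps)
  from multiplicative_proportional_eq[OF mult multiplicative_star[OF mult] y0 this]
  have "star \<mu> \<sigma> g = g" by (rule sym)
  with mult c f2 show ?thesis using that by blast
qed

section \<open>The case of two distinct multiplicative functions\<close>

lemma one_character_impossible:
  assumes chi: "multiplicative \<chi>" and nz: "\<chi> x0 \<noteq> 0"
    and sum: "\<And>x. f x = p x + q x"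
    and right: "\<And>x y. f (x * y) = p x * \<chi> y"
    and left: "\<And>x y. f (y * x) = q x * star \<mu> \<sigma> \<chi> y"
  shows False
proof -
  let ?\<psi> = "star \<mu> \<sigma> \<chi>"
  have psi: "multiplicative ?\<psi>" using chi by (rule multiplicative_star)
  have nz': "?\<psi> (\<sigma> x0) \<noteq> 0" using nz by (rule star_nonzero)
  \<comment> \<open>Equating the two formulas for \<open>f (y * x)\<close> separates the variables,
    so \<open>p\<close> and \<open>q\<close> are the same multiple of \<open>?\<psi>\<close> and
    \<open>\<chi>\<close> respectively.\<close>
  have pq: "p y * \<chi> x = q x * ?\<psi> y" for x y
    using right[of y x] left[of y x] by simp
  define c where "c = q x0 / \<chi> x0"
  have p: "p y = c * ?\<psi> y" for y
    using pq[of y x0] nz by (simp add: c_def field_simps)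
  have q: "q x = c * \<chi> x" for x
    using pq[of "\<sigma> x0" x] nz' by (simp add: p)
  have "c \<noteq> 0" using f_nonzero by (auto simp: sum p q)
  moreover have "c * (\<chi> x * \<chi> y + ?\<psi> x * ?\<psi> y) = c * (?\<psi> x * \<chi> y)" for x y
    using right[of x y] sum[of "x * y"]
    by (simp add: p q multiplicativeD[OF chi] multiplicativeD[OF psi] algebra_simps)
  ultimately have key: "\<chi> x * \<chi> y + ?\<psi> x * ?\<psi> y = ?\<psi> x * \<chi> y" for x y
    by simp
  have "\<chi> = ?\<psi>"
  proof (rule ccontr)
    assume "\<chi> \<noteq> ?\<psi>"
    then obtain w where w: "\<chi> w \<noteq> ?\<psi> w" by auto
    have "\<chi> y = (?\<psi> w / (?\<psi> w - \<chi> w)) * ?\<psi> y" for y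
      using key[of w y] w by (simp add: field_simps)
    from multiplicative_proportional_eq[OF chi psi nz this] \<open>\<chi> \<noteq> ?\<psi>\<close>
    show False by simp
  qed
  \<comment> \<open>With \<open>\<chi> = ?\<psi>\<close>, \<open>key\<close> at \<open>x0\<close>
    doubles the nonzero number \<open>\<chi> x0 * \<chi> x0\<close> without changing it.\<close>
  then show False using key[of x0 x0] nz by (metis add_cancel_right_right mult_eq_0_iff)
qed

lemma two_characters_solution:
  assumes m1: "multiplicative \<chi>1" and m2: "multiplicative \<chi>2" and ne: "\<chi>1 \<noteq> \<chi>2"
    and sum: "\<And>x. f x = p x + q x"
    and right: "\<And>x y. f (x * y) = p x * \<chi>1 y + q x * \<chi>2 y"
    and left: "\<And>x y. f (y * x) = q x * star \<mu> \<sigma> \<chi>1 y + p x * star \<mu> \<sigma> \<chi>2 y"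
  obtains \<alpha> \<delta> where "\<exists>x. \<chi>1 x \<noteq> 0" "\<chi>2 = star \<mu> \<sigma> \<chi>1" "(\<alpha>, \<delta>) \<noteq> (0, 0)"
    "\<And>x. f x = \<alpha> * \<chi>1 x + \<delta> * \<chi>2 x"
proof -
  \<comment> \<open>If one of the two functions vanished, \<open>right\<close> and
    \<open>left\<close> would reduce to the situation of \<open>one_character_impossible\<close>;
    for \<open>\<chi>1\<close> zero, \<open>p\<close> and \<open>q\<close> trade places.\<close>
  have "\<exists>x. \<chi>2 x \<noteq> 0"
  proof (rule ccontr)
    assume *: "\<not> ?thesis"
    then obtain x0 where "\<chi>1 x0 \<noteq> 0" using ne by fastforce
    then show False
      by (rule one_character_impossible[OF m1 _ sum]) (use * right left in \<open>simp_all add: star_def\<close>)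
  qed
  moreover have "\<exists>x. \<chi>1 x \<noteq> 0"
  proof (rule ccontr)
    assume *: "\<not> ?thesis"
    then obtain x0 where "\<chi>2 x0 \<noteq> 0" using ne by fastforce
    then show False
      by (rule one_character_impossible[OF m2 _ sum[unfolded add.commute[of "p _"]]])
        (use * right left in \<open>simp_all add: star_def\<close>)
  qed
  ultimately obtain u v where u: "\<chi>1 u \<noteq> 0" and v: "\<chi>2 v \<noteq> 0" by blast
  note indep = multiplicative_independent_eq[OF m1 m2 u v ne]
  \<comment> \<open>Associativity gives two expansions in \<open>z\<close>; independence allows
    comparing coefficients.\<close>
  have pq: "p (x * y) = p x * \<chi>1 y" "q (x * y) = q x * \<chi>2 y" for x y
  proof -
    have "p (x * y) * \<chi>1 z + q (x * y) * \<chi>2 z = p x * \<chi>1 y * \<chi>1 z + q x * \<chi>2 y * \<chi>2 z" for z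
      using right[of "x * y" z] right[of x "y * z"]
      by (simp add: mult.assoc multiplicativeD[OF m1] multiplicativeD[OF m2])
    from indep[OF this] show "p (x * y) = p x * \<chi>1 y" "q (x * y) = q x * \<chi>2 y"
      by simp_all
  qed
  \<comment> \<open>Here \<open>f (y * (x * w))\<close> is expanded once as a right and once as a
    left translate, and coefficients in \<open>w\<close> are compared.\<close>
  have cross: "p y * \<chi>1 x = p x * star \<mu> \<sigma> \<chi>2 y" "q y * \<chi>2 x = q x * star \<mu> \<sigma> \<chi>1 y" for x y
  proof -
    have "(p y * \<chi>1 x) * \<chi>1 w + (q y * \<chi>2 x) * \<chi>2 w
        = (p x * star \<mu> \<sigma> \<chi>2 y) * \<chi>1 w + (q x * star \<mu> \<sigma> \<chi>1 y) * \<chi>2 w" for w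
      using right[of y "x * w"] left[of y "x * w"]
      by (simp add: pq multiplicativeD[OF m1] multiplicativeD[OF m2] algebra_simps)
    from indep[OF this]
    show "p y * \<chi>1 x = p x * star \<mu> \<sigma> \<chi>2 y" "q y * \<chi>2 x = q x * star \<mu> \<sigma> \<chi>1 y"
      by simp_all
  qed
  have u': "star \<mu> \<sigma> \<chi>1 (\<sigma> u) \<noteq> 0" and v': "star \<mu> \<sigma> \<chi>2 (\<sigma> v) \<noteq> 0"
    by (rule star_nonzero, fact)+
  define \<alpha> where "\<alpha> = p (\<sigma> v) / star \<mu> \<sigma> \<chi>2 (\<sigma> v)"
  define \<delta> where "\<delta> = q (\<sigma> u) / star \<mu> \<sigma> \<chi>1 (\<sigma> u)"
  have p: "p x = \<alpha> * \<chi>1 x" for x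
    using cross(1)[of "\<sigma> v" x] v' by (simp add: \<alpha>_def field_simps)
  have q: "q x = \<delta> * \<chi>2 x" for x
    using cross(2)[of "\<sigma> u" x] u' by (simp add: \<delta>_def field_simps)
  have nz: "(\<alpha>, \<delta>) \<noteq> (0, 0)" using f_nonzero by (auto simp: sum p q)
  \<comment> \<open>Either nonzero coefficient suffices: the matching \<open>cross\<close> identity
    can be divided by it.\<close>
  have "\<chi>2 = star \<mu> \<sigma> \<chi>1"
  proof (cases "\<alpha> = 0")
    case False
    then have "\<chi>1 y = 1 * star \<mu> \<sigma> \<chi>2 y" for y
      using cross(1)[of y u] u by (simp add: p)
    then have "\<chi>1 = star \<mu> \<sigma> \<chi>2" by auto
    then show ?thesis by (simp add: star_star)
  next
    case True
    then have "\<chi>2 y = star \<mu> \<sigma> \<chi>1 y" for y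
      using cross(2)[of y v] v nz by (simp add: q)
    then show ?thesis by auto
  qed
  then show ?thesis using that u nz sum p q by metis
qed

text \<open>All defects share the companion \<open>g\<close>, so the exchange identity with both
  arguments of \<open>g\<close> on the left equal to \<open>z0\<close> can be divided by
  \<open>\<beta>^2 * h z0 * h z0\<close>.\<close>

lemma defect_proportional:
  assumes g: "\<And>x y. g (x * y) = g x * g y + \<beta>^2 * h x * h y" and "\<beta> \<noteq> 0" "h z0 \<noteq> 0"
  shows "defect x y = (defect x z0 / h z0) * h y"
  using sine_addition_law_exchange[OF defect_sine, of x y z0 z0] assms(2,3)
  by (simp add: g field_simps power2_eq_square)

lemma defect_two_characters:
  assumes g: "\<And>x y. g (x * y) = g x * g y + \<beta>^2 * h x * h y"
    and sine: "sine_addition_law h g" and "\<beta> \<noteq> 0" "h z0 \<noteq> 0"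
  obtains \<chi> \<alpha> \<delta> where "multiplicative \<chi>" "\<exists>x. \<chi> x \<noteq> 0" "(\<alpha>, \<delta>) \<noteq> (0, 0)"
    "\<And>x. f x = \<alpha> * \<chi> x + \<delta> * star \<mu> \<sigma> \<chi> x"
    "\<And>x. g x = (\<chi> x + star \<mu> \<sigma> \<chi> x) / 2"
proof -
  define \<chi>1 where "\<chi>1 x = g x + \<beta> * h x" for x
  define \<chi>2 where "\<chi>2 x = g x - \<beta> * h x" for x
  define c where "c x = defect x z0 / h z0" for x
  \<comment> \<open>Substituting \<open>g = (\<chi>1 + \<chi>2) / 2\<close> and
    \<open>h = (\<chi>1 - \<chi>2) / (2 * \<beta>)\<close> into \<open>f x * g y + c x * h y\<close>
    produces these coefficients.\<close>
  define p where "p x = (f x + c x / \<beta>) / 2" for x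
  define q where "q x = (f x - c x / \<beta>) / 2" for x
  have m1: "multiplicative \<chi>1" and m2: "multiplicative \<chi>2"
    by (simp_all add: multiplicative_def \<chi>1_def \<chi>2_def g sine_addition_lawD[OF sine]
        power2_eq_square algebra_simps)
  have "\<chi>1 z0 \<noteq> \<chi>2 z0" using assms(3,4) by (simp add: \<chi>1_def \<chi>2_def)
  then have ne: "\<chi>1 \<noteq> \<chi>2" by auto
  have defect: "defect x = (\<lambda>y. c x * h y)" for x
    unfolding c_def by (rule ext) (rule defect_proportional[OF g assms(3,4)])
  have sum: "f x = p x + q x" for x
    by (simp add: p_def q_def field_simps)
  have right: "f (x * y) = p x * \<chi>1 y + q x * \<chi>2 y" for x y
    using \<open>\<beta> \<noteq> 0\<close> by (simp add: f_mult defect p_def q_def \<chi>1_def \<chi>2_def field_simps)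
  \<comment> \<open>The sign change of the defect in \<open>f_mult_left\<close> interchanges
    \<open>p\<close> and \<open>q\<close>.\<close>
  have left: "f (y * x) = q x * star \<mu> \<sigma> \<chi>1 y + p x * star \<mu> \<sigma> \<chi>2 y" for x y
    using \<open>\<beta> \<noteq> 0\<close>
    by (simp add: f_mult_left defect p_def q_def \<chi>1_def \<chi>2_def star_def field_simps)
  obtain \<alpha> \<delta> where sol: "\<exists>x. \<chi>1 x \<noteq> 0" "\<chi>2 = star \<mu> \<sigma> \<chi>1" "(\<alpha>, \<delta>) \<noteq> (0, 0)"
    "\<And>x. f x = \<alpha> * \<chi>1 x + \<delta> * \<chi>2 x"
    by (rule two_characters_solution[OF m1 m2 ne sum right left]) blast
  have "g x = (\<chi>1 x + \<chi>2 x) / 2" for x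
    by (simp add: \<chi>1_def \<chi>2_def)
  then show ?thesis using that[OF m1 sol(1,3)] sol(4) unfolding sol(2) by blast
qed

section \<open>The case of a multiplicative companion\<close>

lemma defect_mult_left:
  assumes "multiplicative g"
  shows "defect (x * y) z = g y * defect x z"
proof -
  have "f x * g (y * z) + defect x (y * z) = f (x * y) * g z + defect (x * y) z"
    using f_mult[of "x * y" z] f_mult[of x "y * z"] by (simp add: mult.assoc)
  then show ?thesis
    by (simp add: f_mult multiplicativeD[OF assms] sine_addition_lawD[OF defect_sine]
        algebra_simps)
qed

lemma multiplicative_companion_solution:
  assumes mult: "multiplicative g" and nz: "defect a w0 \<noteq> 0"
  obtains k c where "sine_addition_law k g" "g = star \<mu> \<sigma> g" "\<And>x. star \<mu> \<sigma> k x = - k x"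
    "\<And>x. f x = c * g x + k x" "\<exists>x. k x \<noteq> 0"
proof -
  let ?\<psi> = "star \<mu> \<sigma> g"
  have psi: "multiplicative ?\<psi>" using mult by (rule multiplicative_star)
  have compare: "f x * ?\<psi> y - star \<mu> \<sigma> (defect x) y = f y * g x + defect y x" for x y
    using f_mult_left[of y x] f_mult[of y x] by simp
  \<comment> \<open>Subtract \<open>g w\<close> times \<open>compare\<close> from its instance at
    \<open>x * w\<close>: the starred defects cancel by \<open>defect_mult_left\<close>.\<close>
  have key: "defect x w * ?\<psi> y = g x * defect y w" for x y w
  proof -
    have "star \<mu> \<sigma> (defect (x * w)) y = g w * star \<mu> \<sigma> (defect x) y"
      by (simp add: star_def defect_mult_left[OF mult])
    with compare[of "x * w" y]
    have "(f x * g w + defect x w) * ?\<psi> y - g w * star \<mu> \<sigma> (defect x) y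
        = f y * (g x * g w) + (defect y x * g w + g x * defect y w)"
      by (simp add: f_mult[of x w] multiplicativeD[OF mult] sine_addition_lawD[OF defect_sine])
    moreover have "g w * (f x * ?\<psi> y - star \<mu> \<sigma> (defect x) y) = g w * (f y * g x + defect y x)"
      by (simp add: compare)
    ultimately show ?thesis by (simp add: algebra_simps)
  qed
  obtain y0 where y0: "g y0 \<noteq> 0" using g_nonzero by blast
  have ga: "g a \<noteq> 0"
    using key[of a w0 "\<sigma> y0"] nz y0 star_nonzero[of g y0] by auto
  \<comment> \<open>Using \<open>key\<close> in both directions between \<open>a\<close> and
    \<open>x\<close> eliminates \<open>defect x w0\<close>.\<close>
  have "defect a w0 * (g a * g x) = defect a w0 * (?\<psi> a * ?\<psi> x)" for x
    using key[of x w0 a] key[of a w0 x] by algebra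
  then have prod: "g a * g x = ?\<psi> a * ?\<psi> x" for x
    using nz by simp
  have "g x = (?\<psi> a / g a) * ?\<psi> x" for x
    using prod[of x] ga by (simp add: field_simps)
  from multiplicative_proportional_eq[OF mult psi ga this] have fixed: "g = ?\<psi>" .
  \<comment> \<open>Dividing by \<open>g a\<close> gives a single function \<open>k\<close> such
    that the defect at any \<open>x\<close> is \<open>g x\<close> times \<open>k\<close>.\<close>
  define k where "k y = defect a y / g a" for y
  have sine: "sine_addition_law k g"
    unfolding sine_addition_law_def k_def
    by (simp add: sine_addition_lawD[OF defect_sine] add_divide_distrib)
  have defect: "defect x = (\<lambda>y. g x * k y)" for x
    using key[of x _ a] ga by (simp add: fixed[symmetric] k_def fun_eq_iff field_simps)
  have compare': "f x * g y - g x * star \<mu> \<sigma> k y = f y * g x + g y * k x" for x y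
  proof -
    have "star \<mu> \<sigma> (defect x) y = g x * star \<mu> \<sigma> k y"
      by (simp add: star_def defect)
    then show ?thesis using compare[of x y] by (simp add: fixed[symmetric] defect)
  qed
  \<comment> \<open>Solving \<open>compare'\<close> at \<open>y0\<close> for \<open>f x\<close>
    gives this constant.\<close>
  define c where "c = (f y0 + star \<mu> \<sigma> k y0) / g y0"
  have f: "f x = c * g x + k x" for x
    using compare'[of x y0] y0 by (simp add: c_def field_simps)
  have "star \<mu> \<sigma> k y = - k y" for y
  proof -
    have "g y0 * star \<mu> \<sigma> k y = g y0 * (- k y)"
      using compare'[of y0 y] by (simp add: f algebra_simps eq_neg_iff_add_eq_0)
    then show ?thesis unfolding mult_left_cancel[OF y0] .
  qed
  moreover have "k w0 \<noteq> 0" using nz ga by (simp add: k_def)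
  ultimately show ?thesis using that[OF sine fixed _ f] by blast
qed

lemma additive_solution:
  assumes mult: "multiplicative g" and nz: "defect a w0 \<noteq> 0"
  obtains c A where "additive_on (- null_ideal g) A" "\<exists>x\<in>- null_ideal g. A x \<noteq> 0"
    "g = star \<mu> \<sigma> g" "\<forall>x\<in>- null_ideal g. A (\<sigma> x) = - A x"
    "\<forall>x\<in>- null_ideal g. f x = g x * (c + A x)" "\<forall>x\<in>null_ideal g. f x = 0"
proof -
  obtain k c where sine: "sine_addition_law k g" and fixed: "g = star \<mu> \<sigma> g"
    and k: "\<And>x. star \<mu> \<sigma> k x = - k x" and f: "\<And>x. f x = c * g x + k x" and knz: "\<exists>x. k x \<noteq> 0"
    using multiplicative_companion_solution[OF assms] by blast
  have k0: "k x = 0" if "g x = 0" for x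
    using sine_addition_law_vanish[OF squares sine mult that] .
  \<comment> \<open>Dividing the sine law by \<open>g (x * y) = g x * g y\<close> yields additivity
    where \<open>g\<close> is nonzero. Elsewhere the quotient is 0 by convention, so the oddness of
    \<open>A\<close> holds everywhere.\<close>
  define A where "A x = k x / g x" for x
  have "A (\<sigma> x) = - A x" for x
  proof -
    have "A (\<sigma> x) = (\<mu> x * k (\<sigma> x)) / (\<mu> x * g (\<sigma> x))"
      using mu_nonzero by (simp add: A_def)
    also have "\<dots> = - k x / g x"
      using k[of x] fun_cong[OF fixed, of x] by (simp add: star_def)
    finally show ?thesis by (simp add: A_def)
  qed
  moreover have "additive_on (- null_ideal g) A"
    by (simp add: additive_on_def null_ideal_def A_def sine_addition_lawD[OF sine]
        multiplicativeD[OF mult] field_simps)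
  moreover have "\<exists>x\<in>- null_ideal g. A x \<noteq> 0"
    using knz k0 by (force simp: null_ideal_def A_def)
  moreover have "\<forall>x\<in>- null_ideal g. f x = g x * (c + A x)"
    by (simp add: null_ideal_def A_def f field_simps)
  moreover have "\<forall>x\<in>null_ideal g. f x = 0"
    by (simp add: null_ideal_def f k0)
  ultimately show ?thesis using that fixed by blast
qed

section \<open>Case distinction and the classification\<close>

lemma solution_cases:
  obtains (star_sum) \<chi> \<alpha> \<delta> where "multiplicative \<chi>" "\<exists>x. \<chi> x \<noteq> 0" "(\<alpha>, \<delta>) \<noteq> (0, 0)"
    "\<And>x. f x = \<alpha> * \<chi> x + \<delta> * star \<mu> \<sigma> \<chi> x"
    "\<And>x. g x = (\<chi> x + star \<mu> \<sigma> \<chi> x) / 2"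
  | (additive) c A where "multiplicative g" "\<exists>x. g x \<noteq> 0"
    "additive_on (- null_ideal g) A" "\<exists>x\<in>- null_ideal g. A x \<noteq> 0"
    "g = star \<mu> \<sigma> g" "\<forall>x\<in>- null_ideal g. A (\<sigma> x) = - A x"
    "\<forall>x\<in>- null_ideal g. f x = g x * (c + A x)" "\<forall>x\<in>null_ideal g. f x = 0"
proof (cases "\<forall>x y. defect x y = 0")
  case True
  then obtain c where c: "multiplicative g" "star \<mu> \<sigma> g = g" "c \<noteq> 0" "\<And>x. f x = c * g x"
    using defect_zero_solution by blast
  \<comment> \<open>Since \<open>g\<close> is its own star, it is the mean of itself and its
    star.\<close>
  show ?thesis by (rule star_sum[of g c 0]) (use c g_nonzero in auto)
next
  case False
  then obtain a w0 where nz: "defect a w0 \<noteq> 0" by blast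
  obtain \<beta> where g: "\<And>x y. g (x * y) = g x * g y + \<beta>^2 * defect a x * defect a y"
    using sine_addition_law_companion[OF defect_sine nz] by blast
  show ?thesis
  proof (cases "\<beta> = 0")
    case True
    then have mult: "multiplicative g" by (simp add: multiplicative_def g)
    show ?thesis
      by (rule additive_solution[OF mult nz]) (use additive mult g_nonzero in blast)
  next
    case False
    show ?thesis
      by (rule defect_two_characters[OF g defect_sine False nz]) (use star_sum in blast)
  qed
qed

end

theorem theorem4p2:
  fixes \<sigma> :: "'a::semigroup_mult \<Rightarrow> 'a"
    and \<mu> :: "'a \<Rightarrow> complex"
    and f g :: "'a \<Rightarrow> complex"
  assumes "generated_by_squares TYPE('a)"
    and "involutive_automorphism \<sigma>"
    and "multiplicative \<mu>"
    and "\<forall>x. \<mu> (x * \<sigma> x) = 1"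
  shows "(\<forall>x y. f (x * y) + \<mu> y * f (\<sigma> y * x) = 2 * f x * g y) \<longleftrightarrow>
      (\<forall>x. f x = 0)
    \<or> (\<exists>\<chi> (\<alpha>::complex) (\<delta>::complex). multiplicative \<chi> \<and> (\<exists>x. \<chi> x \<noteq> 0) \<and> (\<alpha>, \<delta>) \<noteq> (0, 0)
         \<and> (\<forall>x. f x = \<alpha> * \<chi> x + \<delta> * star \<mu> \<sigma> \<chi> x)
         \<and> (\<forall>x. g x = (\<chi> x + star \<mu> \<sigma> \<chi> x) / 2))
    \<or> (\<exists>\<chi> c A. multiplicative \<chi> \<and> (\<exists>x. \<chi> x \<noteq> 0)
         \<and> additive_on (- null_ideal \<chi>) A \<and> (\<exists>x\<in>- null_ideal \<chi>. A x \<noteq> 0)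
         \<and> \<chi> = star \<mu> \<sigma> \<chi> \<and> (\<forall>x\<in>- null_ideal \<chi>. A (\<sigma> x) = - A x)
         \<and> (\<forall>x\<in>- null_ideal \<chi>. f x = \<chi> x * (c + A x) \<and> g x = \<chi> x)
         \<and> (\<forall>x\<in>null_ideal \<chi>. f x = 0 \<and> g x = 0))"
  (is "?E \<longleftrightarrow> ?Z \<or> ?P \<or> ?Q")
proof -
  interpret mu_involution \<sigma> \<mu>
    using assms(2-4) by unfold_locales auto
  have "?Z \<or> ?P \<or> ?Q" if E: ?E
  proof (cases ?Z)
    case False
    interpret wilson_variant \<sigma> \<mu> f g
      by unfold_locales (use assms(1) E False in auto)
    show ?thesis
    proof (cases rule: solution_cases)
      case (star_sum \<chi> \<alpha> \<delta>)
      then have ?P by blast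
      then show ?thesis by blast
    next
      case (additive c A)
      moreover have "\<forall>x\<in>null_ideal g. g x = 0"
        by (simp add: null_ideal_def)
      ultimately have ?Q by blast
      then show ?thesis by blast
    qed
  qed simp
  moreover have ?E if ?Z
    using that by simp
  moreover have ?E if ?P
    using that star_sum_imp_equation by blast
  moreover have ?E if ?Q
    using that star_fixed_imp_equation by blast
  ultimately show ?thesis by blast
qed

end
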